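(* Let $\mathbb{k}$ be a field and let $\mathcal{G}^2=\{0,\dots,a-1\}\times\{0,\dots,b-1\}\subseteq\mathbb{Z}^2$ ($a,b\ge1$) be a finite two-dimensional grid poset. Let $\alpha$ be an additive invariant on $\mathrm{rep}(\mathcal{G}^2)$ and let $\mathcal{B}$ be a basis for $\alpha$. Assume that: 1. the basis $\mathcal{B}$ only contains spread representations; 2. $\alpha\succcurlyeq\mathcal{N}^2$ as additive invariants. Then $\mathcal{N}^{(\alpha,\mathcal{B})}=\mathcal{N}^2$.
   Context: $\mathrm{rep}(\mathcal{G}^2)$ is the category of functors $\mathcal{G}^2\to\mathrm{vec}$ (finite dimensional $\mathbb{k}$-vector spaces). Padding by zeros, such a representation is seen as a finite dimensional bigraded $\mathbb{k}[\mathbf{x},\mathbf{y}]$-module ($\mathbf{x}:M_i\to M_{i+(1,0)}$, $\mathbf{y}:M_i\to M_{i+(0,1)}$ structure maps), and $\mathcal{N}^2(M)=\dim M-\dim\mathbf{x}M-\dim\mathbf{y}M+\dim\mathbf{x}\mathbf{y}M$. A spread is a non-empty subset $I$ of a poset that is poset-connected (any two elements are joined by a sequence in $I$ whose consecutive elements are comparable) and poset-convex; the spread representation $\mathbb{k}_I$ is $\mathbb{k}$ on $I$, $0$ elsewhere, with identity structure maps within $I$. An additive invariant on an additive category $\mathcal{A}$ is an isomorphism-invariant function $\alpha$ from objects to an abelian group with $\alpha(X\oplus Y)=\alpha(X)+\alpha(Y)$. For additive invariants, $\alpha\succcurlyeq\beta$ means that $\alpha(X)=\alpha(Y)$ implies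 $\beta(X)=\beta(Y)$ for all $X,Y\in\mathcal{A}$. A basis for $\alpha$ is an indexed collection $\mathcal{B}=\{M_i\}_{i\in I}$ of objects such that for each $M\in\mathcal{A}$ there are unique integers $c^M_i$, finitely many nonzero, with $\alpha(M)=\sum_i c_i^M\alpha(M_i)$; then $\mathcal{N}^{(\alpha,\mathcal{B})}(M)=\sum_i c^M_i$. *)

theory Defs
  imports
    "Jordan_Normal_Form.Missing_VectorSpace"
    "HOL-Library.Product_Order"
    "HOL-Library.Product_Plus"
begin

section \<open>Representations of a poset\<close>

definition vec :: "('a, 'k) ring_scheme \<Rightarrow> ('a, 'v) module set" where
  "vec K = {V. vectorspace K V \<and> vectorspace.fin_dim K V}"

text \<open>
  HOL has no set of all vector spaces, so the carriers of the objects are taken from some type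
  \<open>'v\<close>.  The condition below says that \<open>'v\<close> is large enough for the inclusion into the category of
  all finite dimensional vector spaces to be an equivalence; the type \<open>nat \<Rightarrow> 'a\<close> always is,
  see \<open>has_all_dims_fun\<close>.
\<close>

definition has_all_dims :: "('a, 'k) ring_scheme \<Rightarrow> 'v itself \<Rightarrow> bool" where
  "has_all_dims K (_ :: 'v itself) \<longleftrightarrow>
     (\<forall>n. \<exists>V \<in> (vec K :: ('a, 'v) module set). vectorspace.dim K V = n)"

lemma has_all_dims_fun:
  fixes K :: "('a, 'k) ring_scheme"
  assumes "field K"
  shows "has_all_dims K TYPE(nat \<Rightarrow> 'a)"
proof -
  interpret K: field K by fact
  have "\<exists>V \<in> (vec K :: ('a, nat \<Rightarrow> 'a) module set). vectorspace.dim K V = n" for n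
  proof -
    define F where "F = K.func_space {..<n}"
    have car: "carrier F = {..<n} \<rightarrow>\<^sub>E carrier K"
      and add: "\<And>f g. f \<oplus>\<^bsub>F\<^esub> g = (\<lambda>v\<in>{..<n}. f v \<oplus>\<^bsub>K\<^esub> g v)"
      and sm: "\<And>c f. c \<odot>\<^bsub>F\<^esub> f = (\<lambda>v\<in>{..<n}. c \<otimes>\<^bsub>K\<^esub> f v)"
      and zer: "\<zero>\<^bsub>F\<^esub> = (\<lambda>v\<in>{..<n}. \<zero>\<^bsub>K\<^esub>)"
      by (simp_all add: F_def K.func_space_def)
    interpret F: module K F unfolding F_def by (rule K.func_space_is_module)
    interpret F: vectorspace K F by unfold_locales
    define e where "e i = (\<lambda>j\<in>{..<n}. if j = i then \<one>\<^bsub>K\<^esub> else \<zero>\<^bsub>K\<^esub>)" for i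
    define E where "E = e ` {..<n}"
    have eF: "E \<subseteq> carrier F" by (auto simp: E_def e_def car PiE_iff extensional_def split: if_splits)
    have finE: "finite E" by (simp add: E_def)
    have inj: "inj_on e {..<n}"
    proof (rule inj_onI)
      fix i j assume ij: "i \<in> {..<n}" "j \<in> {..<n}" "e i = e j"
      then have "e i i = e j i" by simp
      then show "i = j" using ij by (auto simp: e_def split: if_splits)
    qed
    have pw: "(\<Oplus>\<^bsub>F\<^esub>v\<in>S. f v) j = (\<Oplus>\<^bsub>K\<^esub>v\<in>S. f v j)"
      if "finite S" "f \<in> S \<rightarrow> carrier F" "j < n" for S :: "(nat \<Rightarrow> 'a) set" and f j
      using that
    proof (induction S rule: finite_induct)
      case empty then show ?case by (simp add: zer)
    next
      case (insert x S)
      then have "(\<lambda>v. f v j) \<in> S \<rightarrow> carrier K" "f x j \<in> carrier K"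
        by (auto simp: car PiE_iff Pi_iff)
      with insert show ?case by (simp add: add)
    qed
    have lc: "F.lincomb c E j = c (e j)" if "c \<in> E \<rightarrow> carrier K" "j < n" for c j
    proof -
      have c: "c v \<in> carrier K" if "v \<in> E" for v using \<open>c \<in> _\<close> that by auto
      have "F.lincomb c E j = (\<Oplus>\<^bsub>K\<^esub>v\<in>E. (c v \<odot>\<^bsub>F\<^esub> v) j)"
        unfolding F.lincomb_def using that eF finE c by (intro pw) auto
      also have "\<dots> = (\<Oplus>\<^bsub>K\<^esub>v\<in>E. if e j = v then c v else \<zero>\<^bsub>K\<^esub>)"
      proof (rule K.add.finprod_cong')
        fix v assume v: "v \<in> E"
        then obtain i where i: "i < n" "v = e i" by (auto simp: E_def)
        have "e j = e i \<longleftrightarrow> j = i" using inj i that by (auto dest: inj_onD)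
        then show "(c v \<odot>\<^bsub>F\<^esub> v) j = (if e j = v then c v else \<zero>\<^bsub>K\<^esub>)"
          using that i c[OF v] by (auto simp: sm e_def)
      qed (use c in auto)
      also have "\<dots> = c (e j)"
        using that c finE by (intro K.add.finprod_singleton) (auto simp: E_def)
      finally show ?thesis .
    qed
    have lcF: "F.lincomb c E \<in> carrier F" if "c \<in> E \<rightarrow> carrier K" for c
      using that eF finE by (intro F.lincomb_closed) auto
    have "F.basis E"
      unfolding F.basis_criterion[OF finE eF]
    proof (intro allI impI)
      fix v assume v: "v \<in> carrier F"
      define c where "c = (\<lambda>w\<in>E. v (the_inv_into {..<n} e w))"
      have ce: "c (e j) = v j" if "j < n" for j
        using that inj by (simp add: c_def E_def the_inv_into_f_f)
      have cP: "c \<in> E \<rightarrow>\<^sub>E carrier K"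
        using v ce by (auto simp: E_def car PiE_iff) (auto simp: c_def E_def)
      show "\<exists>!a. a \<in> E \<rightarrow>\<^sub>E carrier K \<and> F.lincomb a E = v"
      proof (rule ex1I[of _ c], intro conjI cP)
        have cP': "c \<in> E \<rightarrow> carrier K" using cP by (auto simp: PiE_iff)
        show "F.lincomb c E = v"
          using lcF[OF cP'] v lc[OF cP'] ce unfolding car by (intro PiE_ext) auto
      next
        fix a assume a: "a \<in> E \<rightarrow>\<^sub>E carrier K \<and> F.lincomb a E = v"
        then have aP: "a \<in> E \<rightarrow> carrier K" by (auto simp: PiE_iff)
        show "a = c"
        proof (rule PiE_ext[OF conjunct1[OF a] cP])
          fix w assume "w \<in> E"
          then obtain j where "j < n" "w = e j" by (auto simp: E_def)
          then show "a w = c w" using lc[OF aP] a ce by auto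
        qed
      qed
    qed
    then have "F.dim = n" and "F.fin_dim"
      using F.dim_basis[OF finE] inj finE eF
      by (auto simp: E_def card_image F.fin_dim_def F.basis_def)
    then show ?thesis
      using F.vectorspace_axioms by (auto simp: vec_def)
  qed
  then show ?thesis by (simp add: has_all_dims_def)
qed

text \<open>
  A representation assigns a space to every point and a map to every pair \<open>p \<le> q\<close>.  Only the values
  on the poset \<open>P\<close>, and of the maps on the carriers, are meaningful.
\<close>

record ('p, 'a, 'v) rep =
  ob :: "'p \<Rightarrow> ('a, 'v) module"
  mp :: "'p \<Rightarrow> 'p \<Rightarrow> 'v \<Rightarrow> 'v"

definition reps :: "('a, 'k) ring_scheme \<Rightarrow> 'p::order set \<Rightarrow> ('p, 'a, 'v) rep set" where
  "reps K P = {M.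
     (\<forall>p\<in>P. ob M p \<in> vec K) \<and>
     (\<forall>p\<in>P. \<forall>q\<in>P. p \<le> q \<longrightarrow> linear_map K (ob M p) (ob M q) (mp M p q)) \<and>
     (\<forall>p\<in>P. \<forall>v\<in>carrier (ob M p). mp M p p v = v) \<and>
     (\<forall>p\<in>P. \<forall>q\<in>P. \<forall>r\<in>P. p \<le> q \<longrightarrow> q \<le> r \<longrightarrow>
        (\<forall>v\<in>carrier (ob M p). mp M p r v = mp M q r (mp M p q v)))}"

text \<open>The two carrier types may differ.\<close>

definition rep_iso ::
  "('a, 'k) ring_scheme \<Rightarrow> 'p::order set \<Rightarrow> ('p, 'a, 'v) rep \<Rightarrow> ('p, 'a, 'w) rep \<Rightarrow> bool" where
  "rep_iso K P M N \<longleftrightarrow> (\<exists>\<phi>.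
     (\<forall>p\<in>P. linear_map K (ob M p) (ob N p) (\<phi> p) \<and>
             bij_betw (\<phi> p) (carrier (ob M p)) (carrier (ob N p))) \<and>
     (\<forall>p\<in>P. \<forall>q\<in>P. p \<le> q \<longrightarrow>
        (\<forall>v\<in>carrier (ob M p). \<phi> q (mp M p q v) = mp N p q (\<phi> p v))))"

definition rep_sum :: "('p, 'a, 'v) rep \<Rightarrow> ('p, 'a, 'w) rep \<Rightarrow> ('p, 'a, 'v \<times> 'w) rep" where
  "rep_sum M N = \<lparr>
     ob = (\<lambda>p. direct_sum (ob M p) (ob N p)),
     mp = (\<lambda>p q. map_prod (mp M p q) (mp N p q))\<rparr>"


section \<open>Spread representations\<close>

definition poset_connected :: "'p::order set \<Rightarrow> bool" where
  "poset_connected S \<longleftrightarrow>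
     (\<forall>p\<in>S. \<forall>q\<in>S. (p, q) \<in> {(x, y). x \<in> S \<and> y \<in> S \<and> (x \<le> y \<or> y \<le> x)}\<^sup>*)"

definition poset_convex :: "'p::order set \<Rightarrow> 'p set \<Rightarrow> bool" where
  "poset_convex P S \<longleftrightarrow> (\<forall>p\<in>S. \<forall>r\<in>S. \<forall>q\<in>P. p \<le> q \<longrightarrow> q \<le> r \<longrightarrow> q \<in> S)"

definition spread :: "'p::order set \<Rightarrow> 'p set \<Rightarrow> bool" where
  "spread P S \<longleftrightarrow> S \<subseteq> P \<and> S \<noteq> {} \<and> poset_connected S \<and> poset_convex P S"

definition self_module :: "('a, 'k) ring_scheme \<Rightarrow> ('a, 'a) module" where
  "self_module K = \<lparr>carrier = carrier K, mult = mult K, one = one K,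
                    zero = zero K, add = add K, smult = mult K\<rparr>"

definition spread_rep :: "('a, 'k) ring_scheme \<Rightarrow> 'p set \<Rightarrow> ('p, 'a, 'a) rep" where
  "spread_rep K S = \<lparr>
     ob = (\<lambda>p. if p \<in> S then self_module K else (self_module K)\<lparr>carrier := {\<zero>\<^bsub>K\<^esub>}\<rparr>),
     mp = (\<lambda>p q v. if p \<in> S \<and> q \<in> S then v else \<zero>\<^bsub>K\<^esub>)\<rparr>"

definition is_spread_rep :: "('a, 'k) ring_scheme \<Rightarrow> 'p::order set \<Rightarrow> ('p, 'a, 'v) rep \<Rightarrow> bool" where
  "is_spread_rep K P M \<longleftrightarrow> (\<exists>S. spread P S \<and> rep_iso K P M (spread_rep K S))"


section \<open>Additive invariants and bases\<close>

text \<open>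
  The abelian group is \<open>A\<close>, written additively; its ring multiplication is irrelevant.  As
  \<open>rep_sum X Y\<close> has its carriers in a product type, additivity is stated for every object
  isomorphic to the direct sum.
\<close>

definition additive_invariant ::
  "('a, 'k) ring_scheme \<Rightarrow> 'p::order set \<Rightarrow> ('g, 'h) ring_scheme \<Rightarrow>
   (('p, 'a, 'v) rep \<Rightarrow> 'g) \<Rightarrow> bool" where
  "additive_invariant K P A \<alpha> \<longleftrightarrow>
     abelian_group A \<and>
     (\<forall>X\<in>reps K P. \<alpha> X \<in> carrier A) \<and>
     (\<forall>X\<in>reps K P. \<forall>Y\<in>reps K P. rep_iso K P X Y \<longrightarrow> \<alpha> X = \<alpha> Y) \<and>
     (\<forall>X\<in>reps K P. \<forall>Y\<in>reps K P. \<forall>Z\<in>reps K P.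
        rep_iso K P Z (rep_sum X Y) \<longrightarrow> \<alpha> Z = \<alpha> X \<oplus>\<^bsub>A\<^esub> \<alpha> Y)"

definition finer ::
  "('a, 'k) ring_scheme \<Rightarrow> 'p::order set \<Rightarrow>
   (('p, 'a, 'v) rep \<Rightarrow> 'g) \<Rightarrow> (('p, 'a, 'v) rep \<Rightarrow> 'h) \<Rightarrow> bool" where
  "finer K P \<alpha> \<beta> \<longleftrightarrow> (\<forall>X\<in>reps K P. \<forall>Y\<in>reps K P. \<alpha> X = \<alpha> Y \<longrightarrow> \<beta> X = \<beta> Y)"

text \<open>Coefficients are extended by zero outside \<open>I\<close>, which makes uniqueness of functions on the
  whole index type the same as uniqueness of families indexed by \<open>I\<close>.\<close>

definition is_expansion ::
  "('g, 'h) ring_scheme \<Rightarrow> ('r \<Rightarrow> 'g) \<Rightarrow> 'i set \<Rightarrow> ('i \<Rightarrow> 'r) \<Rightarrow> 'r \<Rightarrow> ('i \<Rightarrow> int) \<Rightarrow> bool" where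
  "is_expansion A \<alpha> I B M c \<longleftrightarrow>
     (\<forall>i. i \<notin> I \<longrightarrow> c i = 0) \<and> finite {i. c i \<noteq> 0} \<and>
     \<alpha> M = (\<Oplus>\<^bsub>A\<^esub>i\<in>{i. c i \<noteq> 0}. [c i] \<cdot>\<^bsub>A\<^esub> \<alpha> (B i))"

definition is_basis ::
  "('a, 'k) ring_scheme \<Rightarrow> 'p::order set \<Rightarrow> ('g, 'h) ring_scheme \<Rightarrow>
   (('p, 'a, 'v) rep \<Rightarrow> 'g) \<Rightarrow> 'i set \<Rightarrow> ('i \<Rightarrow> ('p, 'a, 'v) rep) \<Rightarrow> bool" where
  "is_basis K P A \<alpha> I B \<longleftrightarrow>
     (\<forall>i\<in>I. B i \<in> reps K P) \<and> (\<forall>M\<in>reps K P. \<exists>!c. is_expansion A \<alpha> I B M c)"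

definition basis_coeffs ::
  "('g, 'h) ring_scheme \<Rightarrow> ('r \<Rightarrow> 'g) \<Rightarrow> 'i set \<Rightarrow> ('i \<Rightarrow> 'r) \<Rightarrow> 'r \<Rightarrow> 'i \<Rightarrow> int" where
  "basis_coeffs A \<alpha> I B M = (THE c. is_expansion A \<alpha> I B M c)"

definition N_basis ::
  "('g, 'h) ring_scheme \<Rightarrow> ('r \<Rightarrow> 'g) \<Rightarrow> 'i set \<Rightarrow> ('i \<Rightarrow> 'r) \<Rightarrow> 'r \<Rightarrow> int" where
  "N_basis A \<alpha> I B M = (\<Sum>i\<in>{i. basis_coeffs A \<alpha> I B M i \<noteq> 0}. basis_coeffs A \<alpha> I B M i)"


section \<open>Grids and the bigraded module of a representation\<close>

text \<open>The order on \<open>int \<times> int\<close> is the componentwise one.\<close>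

definition grid :: "nat \<Rightarrow> nat \<Rightarrow> (int \<times> int) set" where
  "grid a b = {0..<int a} \<times> {0..<int b}"

text \<open>
  The underlying vector space of the bigraded module of \<open>M\<close>, the direct sum of the finitely many
  spaces \<open>ob M p\<close>; the degrees outside \<open>P\<close>, where the padded module vanishes, are left out.
  The fields \<open>mult\<close> and \<open>one\<close> of the record play no role.
\<close>

definition total :: "(int \<times> int) set \<Rightarrow> (int \<times> int, 'a, 'v) rep \<Rightarrow> ('a, int \<times> int \<Rightarrow> 'v) module" where
  "total P M = \<lparr>
     carrier = (\<Pi>\<^sub>E p\<in>P. carrier (ob M p)),
     mult = (\<lambda>m n. \<lambda>p\<in>P. \<zero>\<^bsub>ob M p\<^esub>),
     one = (\<lambda>p\<in>P. \<zero>\<^bsub>ob M p\<^esub>),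
     zero = (\<lambda>p\<in>P. \<zero>\<^bsub>ob M p\<^esub>),
     add = (\<lambda>m n. \<lambda>p\<in>P. m p \<oplus>\<^bsub>ob M p\<^esub> n p),
     smult = (\<lambda>c m. \<lambda>p\<in>P. c \<odot>\<^bsub>ob M p\<^esub> m p)\<rparr>"

text \<open>Multiplication by the monomial of degree \<open>d\<close>, for \<open>d \<ge> 0\<close>.\<close>

definition shift ::
  "(int \<times> int) set \<Rightarrow> (int \<times> int, 'a, 'v) rep \<Rightarrow> int \<times> int \<Rightarrow> (int \<times> int \<Rightarrow> 'v) \<Rightarrow> int \<times> int \<Rightarrow> 'v" where
  "shift P M d m = (\<lambda>p\<in>P. if p - d \<in> P then mp M (p - d) p (m (p - d)) else \<zero>\<^bsub>ob M p\<^esub>)"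

definition N2 :: "('a, 'k) ring_scheme \<Rightarrow> (int \<times> int) set \<Rightarrow> (int \<times> int, 'a, 'v) rep \<Rightarrow> int" where
  "N2 K P M = (let
      T = total P M;
      x = shift P M (1, 0);
      y = shift P M (0, 1);
      dm = (\<lambda>W. int (vectorspace.dim K (T\<lparr>carrier := W\<rparr>)))
    in dm (carrier T) - dm (x ` carrier T) - dm (y ` carrier T) + dm (x ` y ` carrier T))"

end

theory Submission
  imports Defs
begin

text \<open>
  On a grid, \<open>N2\<close> is an alternating sum of ranks of structure maps, hence invariant under isomorphism
  and additive.  On a spread it counts points minus horizontal and vertical edges plus unit squares,
  the Euler characteristic of a connected and simply connected cubical complex, so it is 1.
  If \<open>\<alpha> M\<close> is an integer combination of the \<open>\<alpha> (B i)\<close>, bringing negative terms to the other side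
  gives two representations with equal \<open>\<alpha>\<close>, therefore with equal \<open>N2\<close>, and additivity of \<open>N2\<close> shows
  that \<open>N2\<close> of \<open>M\<close> is the sum of the coefficients.
\<close>

section \<open>Finite dimensional vector spaces\<close>

lemma linear_mapI:
  assumes "vectorspace K V" "vectorspace K W"
    and "\<And>v. v \<in> carrier V \<Longrightarrow> f v \<in> carrier W"
    and "\<And>v w. v \<in> carrier V \<Longrightarrow> w \<in> carrier V \<Longrightarrow> f (v \<oplus>\<^bsub>V\<^esub> w) = f v \<oplus>\<^bsub>W\<^esub> f w"
    and "\<And>c v. c \<in> carrier K \<Longrightarrow> v \<in> carrier V \<Longrightarrow> f (c \<odot>\<^bsub>V\<^esub> v) = c \<odot>\<^bsub>W\<^esub> f v"
  shows "linear_map K V W f"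
  using assms
  by (intro linear_map.intro mod_hom.intro mod_hom_axioms.intro)
    (auto simp: vectorspace_def module_hom_def)

lemma linear_mapD:
  assumes "linear_map K V W f"
  shows "vectorspace K V" "vectorspace K W"
    and "\<And>v. v \<in> carrier V \<Longrightarrow> f v \<in> carrier W"
    and "\<And>v w. v \<in> carrier V \<Longrightarrow> w \<in> carrier V \<Longrightarrow> f (v \<oplus>\<^bsub>V\<^esub> w) = f v \<oplus>\<^bsub>W\<^esub> f w"
    and "\<And>c v. c \<in> carrier K \<Longrightarrow> v \<in> carrier V \<Longrightarrow> f (c \<odot>\<^bsub>V\<^esub> v) = c \<odot>\<^bsub>W\<^esub> f v"
    and "f \<zero>\<^bsub>V\<^esub> = \<zero>\<^bsub>W\<^esub>"
proof -
  interpret linear_map K V W f by fact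
  show "vectorspace K V" "vectorspace K W" by unfold_locales
  show "f v \<in> carrier W" if "v \<in> carrier V" for v using that by simp
  show "f (v \<oplus>\<^bsub>V\<^esub> w) = f v \<oplus>\<^bsub>W\<^esub> f w" if "v \<in> carrier V" "w \<in> carrier V" for v w using that by simp
  show "f (c \<odot>\<^bsub>V\<^esub> v) = c \<odot>\<^bsub>W\<^esub> f v" if "c \<in> carrier K" "v \<in> carrier V" for c v using that by simp
  show "f \<zero>\<^bsub>V\<^esub> = \<zero>\<^bsub>W\<^esub>" by simp
qed

lemma vectorspace_closed:
  assumes "vectorspace K V"
  shows "\<And>v w. v \<in> carrier V \<Longrightarrow> w \<in> carrier V \<Longrightarrow> v \<oplus>\<^bsub>V\<^esub> w \<in> carrier V"
    and "\<And>c v. c \<in> carrier K \<Longrightarrow> v \<in> carrier V \<Longrightarrow> c \<odot>\<^bsub>V\<^esub> v \<in> carrier V"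
    and "\<zero>\<^bsub>V\<^esub> \<in> carrier V"
proof -
  interpret vectorspace K V by fact
  show "v \<oplus>\<^bsub>V\<^esub> w \<in> carrier V" if "v \<in> carrier V" "w \<in> carrier V" for v w using that by simp
  show "c \<odot>\<^bsub>V\<^esub> v \<in> carrier V" if "c \<in> carrier K" "v \<in> carrier V" for c v using that by simp
  show "\<zero>\<^bsub>V\<^esub> \<in> carrier V" by simp
qed

definition lin_iso ::
  "('a, 'k) ring_scheme \<Rightarrow> ('a, 'v) module \<Rightarrow> ('a, 'w) module \<Rightarrow> ('v \<Rightarrow> 'w) \<Rightarrow> bool" where
  "lin_iso K V W f \<longleftrightarrow> linear_map K V W f \<and> bij_betw f (carrier V) (carrier W)"

lemma linear_map_comp:
  assumes "linear_map K V W f" "linear_map K W U g"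
  shows "linear_map K V U (\<lambda>v. g (f v))"
  using linear_mapD[OF assms(1)] linear_mapD[OF assms(2)] by (intro linear_mapI) auto

lemma lin_iso_comp:
  assumes "lin_iso K V W f" "lin_iso K W U g"
  shows "lin_iso K V U (\<lambda>v. g (f v))"
  using assms linear_map_comp[of K V W f U g] bij_betw_trans[of f _ _ g]
  by (auto simp: lin_iso_def comp_def)

lemma lin_iso_inv:
  assumes "lin_iso K V W f"
  shows "lin_iso K W V (inv_into (carrier V) f)"
proof -
  let ?g = "inv_into (carrier V) f"
  have lf: "linear_map K V W f" and bij: "bij_betw f (carrier V) (carrier W)"
    using assms by (auto simp: lin_iso_def)
  note f = linear_mapD[OF lf]
  have gc: "?g w \<in> carrier V" and fg: "f (?g w) = w" if "w \<in> carrier W" for w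
    using bij that by (auto simp: bij_betw_def inv_into_into f_inv_into_f)
  have gf: "?g (f v) = v" if "v \<in> carrier V" for v
    using bij that by (auto simp: bij_betw_def)
  have "linear_map K W V ?g"
  proof (rule linear_mapI)
    fix v w assume "v \<in> carrier W" "w \<in> carrier W"
    then show "?g (v \<oplus>\<^bsub>W\<^esub> w) = ?g v \<oplus>\<^bsub>V\<^esub> ?g w"
      using gf[of "?g v \<oplus>\<^bsub>V\<^esub> ?g w"] by (simp add: gc fg f(4) vectorspace_closed[OF f(1)])
  next
    fix c w assume "c \<in> carrier K" "w \<in> carrier W"
    then show "?g (c \<odot>\<^bsub>W\<^esub> w) = c \<odot>\<^bsub>V\<^esub> ?g w"
      using gf[of "c \<odot>\<^bsub>V\<^esub> ?g w"] by (simp add: gc fg f(5) vectorspace_closed[OF f(1)])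
  qed (use f gc in auto)
  with bij_betw_inv_into[OF bij] show ?thesis by (simp add: lin_iso_def)
qed

lemma surj_vec:
  assumes "V \<in> vec K" "linear_map K V W f" "f ` carrier V = carrier W"
  shows "W \<in> vec K"
  using linear_map.surj_fin_dim[of K V W f] assms linear_mapD(2)[of K V W f] by (auto simp: vec_def)

lemma lin_iso_vec:
  assumes "V \<in> vec K" "lin_iso K V W f"
  shows "W \<in> vec K" "vectorspace.dim K V = vectorspace.dim K W"
  using surj_vec[of V K W f] linear_map.dim_eq[of K V W f] assms
  by (auto simp: lin_iso_def bij_betw_def vec_def)

lemma image_vectorspace:
  assumes "linear_map K V W f"
  shows "vectorspace K (W\<lparr>carrier := f ` carrier V\<rparr>)"
proof -
  interpret linear_map K V W f by fact
  from imT_is_subspace have "subspace K (f ` carrier V) W" by (simp add: im_def)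
  then show ?thesis using W.subspace_is_vs by simp
qed

lemma image_vec:
  assumes "V \<in> vec K" "linear_map K V W f"
  shows "W\<lparr>carrier := f ` carrier V\<rparr> \<in> vec K"
proof (rule surj_vec[OF assms(1)])
  show "linear_map K V (W\<lparr>carrier := f ` carrier V\<rparr>) f"
    using linear_mapD[OF assms(2)] image_vectorspace[OF assms(2)] by (intro linear_mapI) auto
qed auto

lemma zero_vec:
  assumes "vectorspace K V" "carrier V = {\<zero>\<^bsub>V\<^esub>}"
  shows "V \<in> vec K" "vectorspace.dim K V = 0"
proof -
  interpret vectorspace K V by fact
  have "gen_set {\<zero>\<^bsub>V\<^esub>}"
    using span_closed[of "{\<zero>\<^bsub>V\<^esub>}"] span_zero[of "{\<zero>\<^bsub>V\<^esub>}"] assms(2) by auto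
  then show "V \<in> vec K" "dim = 0"
    using dim0I vectorspace_axioms by (auto simp: vec_def fin_dim_def intro!: exI[of _ "{\<zero>\<^bsub>V\<^esub>}"])
qed

section \<open>Direct sums of two finite dimensional spaces\<close>

lemma direct_sum_simps [simp]:
  "carrier (direct_sum V W) = carrier V \<times> carrier W"
  "v \<oplus>\<^bsub>direct_sum V W\<^esub> w = (fst v \<oplus>\<^bsub>V\<^esub> fst w, snd v \<oplus>\<^bsub>W\<^esub> snd w)"
  "c \<odot>\<^bsub>direct_sum V W\<^esub> v = (c \<odot>\<^bsub>V\<^esub> fst v, c \<odot>\<^bsub>W\<^esub> snd v)"
  "\<zero>\<^bsub>direct_sum V W\<^esub> = (\<zero>\<^bsub>V\<^esub>, \<zero>\<^bsub>W\<^esub>)"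
  by (simp_all add: direct_sum_def)

text \<open>Copies of a generating set of \<open>V\<close> and of one of \<open>W\<close>, placed in
  the two coordinates, together generate the sum.\<close>

lemma direct_sum_vec:
  fixes V :: "('a, 'v) module" and W :: "('a, 'w) module"
  assumes "V \<in> vec K" "W \<in> vec K"
  shows "direct_sum V W \<in> vec K"
proof -
  interpret V: vectorspace K V using assms by (simp add: vec_def)
  interpret W: vectorspace K W using assms by (simp add: vec_def)
  interpret U: vectorspace K "direct_sum V W"
    by (rule direct_sum_is_vs) unfold_locales
  obtain A B where A: "finite A" "A \<subseteq> carrier V" "V.gen_set A"
    and B: "finite B" "B \<subseteq> carrier W" "W.gen_set B"
    using assms by (auto simp: vec_def V.fin_dim_def W.fin_dim_def)
  define G where "G = (\<lambda>v. (v, \<zero>\<^bsub>W\<^esub>)) ` A \<union> (\<lambda>w. (\<zero>\<^bsub>V\<^esub>, w)) ` B"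
  have GU: "G \<subseteq> carrier (direct_sum V W)" using A B by (auto simp: G_def)
  then have sub: "submodule K (U.span G) (direct_sum V W)" by (rule U.span_is_submodule)
  note S = submodule.m_closed[OF sub] submodule.smult_closed[OF sub]
    submodule.zero_closed[OF sub]
  have GS: "g \<in> U.span G" if "g \<in> G" for g using GU that U.span_mem by blast
  \<comment> \<open>The vectors of \<open>V\<close> whose copy lies in the span form a submodule
    containing \<open>A\<close>, hence they exhaust \<open>V\<close>; the same argument serves
    \<open>W\<close>.\<close>
  have "submodule K {v \<in> carrier V. (v, \<zero>\<^bsub>W\<^esub>) \<in> U.span G} V"
    using S(1)[of "(_, \<zero>\<^bsub>W\<^esub>)" "(_, \<zero>\<^bsub>W\<^esub>)"] S(2)[of _ "(_, \<zero>\<^bsub>W\<^esub>)"] S(3)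
    by (intro submodule.intro) (auto simp: V.module_axioms)
  then have "V.span A \<subseteq> {v \<in> carrier V. (v, \<zero>\<^bsub>W\<^esub>) \<in> U.span G}"
    using A(2) GS by (intro V.span_is_subset) (auto simp: G_def)
  moreover have "submodule K {w \<in> carrier W. (\<zero>\<^bsub>V\<^esub>, w) \<in> U.span G} W"
    using S(1)[of "(\<zero>\<^bsub>V\<^esub>, _)" "(\<zero>\<^bsub>V\<^esub>, _)"] S(2)[of _ "(\<zero>\<^bsub>V\<^esub>, _)"] S(3)
    by (intro submodule.intro) (auto simp: W.module_axioms)
  then have "W.span B \<subseteq> {w \<in> carrier W. (\<zero>\<^bsub>V\<^esub>, w) \<in> U.span G}"
    using B(2) GS by (intro W.span_is_subset) (auto simp: G_def)
  ultimately have "(v, w) \<in> U.span G" if "v \<in> carrier V" "w \<in> carrier W" for v w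
    using S(1)[of "(v, \<zero>\<^bsub>W\<^esub>)" "(\<zero>\<^bsub>V\<^esub>, w)"] that A(3) B(3) by auto
  then have "U.gen_set G" using U.span_closed[OF GU] by auto
  moreover have "finite G" using A B by (simp add: G_def)
  ultimately have "U.fin_dim" using GU U.fin_dim_def by blast
  then show ?thesis using U.vectorspace_axioms by (simp add: vec_def)
qed

text \<open>Rank-nullity for the first projection: it is onto \<open>V\<close>, and its kernel is a
  copy of \<open>W\<close>.\<close>

lemma dim_direct_sum:
  fixes V :: "('a, 'v) module" and W :: "('a, 'w) module"
  assumes "V \<in> vec K" "W \<in> vec K"
  shows "vectorspace.dim K (direct_sum V W) = vectorspace.dim K V + vectorspace.dim K W"
proof -
  interpret V: vectorspace K V using assms by (simp add: vec_def)
  interpret W: vectorspace K W using assms by (simp add: vec_def)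
  have U: "direct_sum V W \<in> vec K" using assms by (rule direct_sum_vec)
  interpret p: linear_map K "direct_sum V W" V fst
    using U V.vectorspace_axioms by (intro linear_mapI) (auto simp: vec_def)
  have "p.im = carrier V" unfolding p.im_def using W.zero_closed by force
  then have "vectorspace.dim K (direct_sum V W) =
      V.dim + vectorspace.dim K ((direct_sum V W)\<lparr>carrier := p.ker\<rparr>)"
    using p.rank_nullity U by (simp add: vec_def)
  moreover have "lin_iso K W ((direct_sum V W)\<lparr>carrier := p.ker\<rparr>) (\<lambda>w. (\<zero>\<^bsub>V\<^esub>, w))"
    unfolding lin_iso_def
  proof
    have ker: "p.ker = {\<zero>\<^bsub>V\<^esub>} \<times> carrier W" by (auto simp: p.ker_def)
    show "linear_map K W ((direct_sum V W)\<lparr>carrier := p.ker\<rparr>) (\<lambda>w. (\<zero>\<^bsub>V\<^esub>, w))"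
      using p.V.subspace_is_vs[OF p.kerT_is_subspace] W.vectorspace_axioms
      by (intro linear_mapI) (simp_all add: ker)
    show "bij_betw (\<lambda>w. (\<zero>\<^bsub>V\<^esub>, w)) (carrier W) (carrier ((direct_sum V W)\<lparr>carrier := p.ker\<rparr>))"
      by (rule bij_betwI[where g = snd]) (auto simp: ker)
  qed
  then have "W.dim = vectorspace.dim K ((direct_sum V W)\<lparr>carrier := p.ker\<rparr>)"
    by (rule lin_iso_vec(2)[OF assms(2)])
  ultimately show ?thesis by simp
qed

section \<open>Spaces of equal dimension are isomorphic\<close>

lemma reindex_lin_iso:
  assumes "vectorspace K V" "bij_betw h \<gamma> \<beta>"
  shows "lin_iso K (ring.func_space K \<beta>) (ring.func_space K \<gamma>) (\<lambda>a. \<lambda>w\<in>\<gamma>. a (h w))"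
proof -
  interpret V: vectorspace K V by fact
  let ?k = "inv_into \<gamma> h"
  have h: "h w \<in> \<beta>" "?k (h w) = w" if "w \<in> \<gamma>" for w
    using assms(2) that by (auto simp: bij_betw_def)
  have k: "?k v \<in> \<gamma>" "h (?k v) = v" if "v \<in> \<beta>" for v
    using assms(2) that by (auto simp: bij_betw_def inv_into_into f_inv_into_f)
  have "linear_map K (V.func_space \<beta>) (V.func_space \<gamma>) (\<lambda>a. \<lambda>w\<in>\<gamma>. a (h w))"
    using h by (intro linear_mapI V.func_space_is_vs)
      (auto simp: V.func_space_def PiE_iff Pi_iff intro!: restrict_ext)
  moreover have "bij_betw (\<lambda>a. \<lambda>w\<in>\<gamma>. a (h w)) (\<beta> \<rightarrow>\<^sub>E carrier K) (\<gamma> \<rightarrow>\<^sub>E carrier K)"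
  proof (rule bij_betwI[where g = "\<lambda>b. \<lambda>v\<in>\<beta>. b (?k v)"])
    show "(\<lambda>v\<in>\<beta>. (\<lambda>w\<in>\<gamma>. a (h w)) (?k v)) = a" if "a \<in> \<beta> \<rightarrow>\<^sub>E carrier K" for a
      using that k by (auto simp: fun_eq_iff PiE_iff extensional_def)
    show "(\<lambda>w\<in>\<gamma>. (\<lambda>v\<in>\<beta>. b (?k v)) (h w)) = b" if "b \<in> \<gamma> \<rightarrow>\<^sub>E carrier K" for b
      using that h by (auto simp: fun_eq_iff PiE_iff extensional_def)
  qed (use h k in auto)
  ultimately show ?thesis by (simp add: lin_iso_def V.func_space_def)
qed

text \<open>Coordinates with respect to a basis exist and are unique, so forming linear combinations
  is a bijection from the coordinate space.\<close>

lemma coordinates_lin_iso: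
  assumes "V \<in> vec K"
  obtains \<beta> where "finite \<beta>" "card \<beta> = vectorspace.dim K V"
    "lin_iso K (ring.func_space K \<beta>) V (\<lambda>a. module.lincomb V a \<beta>)"
proof -
  interpret V: vectorspace K V using assms by (simp add: vec_def)
  obtain \<beta> where \<beta>: "finite \<beta>" "V.basis \<beta>"
    using V.finite_basis_exists assms by (auto simp: vec_def)
  then have c: "\<beta> \<subseteq> carrier V" by (simp add: V.basis_def)
  interpret l: linear_map K "V.func_space \<beta>" V "\<lambda>a. V.lincomb a \<beta>"
    by (rule V.lincomb_is_linear[OF \<beta>(1) c])
  have "\<forall>v. v \<in> carrier V \<longrightarrow> (\<exists>!a. a \<in> carrier (V.func_space \<beta>) \<and> V.lincomb a \<beta> = v)"
    using V.basis_criterion[OF \<beta>(1) c] \<beta>(2) by (simp add: V.func_space_def)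
  then have "bij_betw (\<lambda>a. V.lincomb a \<beta>) (carrier (V.func_space \<beta>)) (carrier V)"
    unfolding bij_betw_def inj_on_def using l.T_im by (auto simp: image_iff)
  then show ?thesis
    using that[OF \<beta>(1)] V.dim_basis[OF \<beta>] l.linear_map_axioms by (simp add: lin_iso_def)
qed

text \<open>Both spaces are compared with coordinate spaces whose index sets have equal size. The
  carrier types of \<open>V\<close> and \<open>W\<close> may differ, which is what moving a direct
  sum back to the type \<open>'v\<close> requires.\<close>

lemma lin_iso_exists:
  assumes "V \<in> vec K" "W \<in> vec K" "vectorspace.dim K V = vectorspace.dim K W"
  obtains f where "lin_iso K V W f"
proof -
  obtain \<beta> where \<beta>: "finite \<beta>" "card \<beta> = vectorspace.dim K V"
    "lin_iso K (ring.func_space K \<beta>) V (\<lambda>a. module.lincomb V a \<beta>)"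
    using coordinates_lin_iso[OF assms(1)] .
  obtain \<gamma> where \<gamma>: "finite \<gamma>" "card \<gamma> = vectorspace.dim K W"
    "lin_iso K (ring.func_space K \<gamma>) W (\<lambda>a. module.lincomb W a \<gamma>)"
    using coordinates_lin_iso[OF assms(2)] .
  obtain h where "bij_betw h \<gamma> \<beta>"
    using finite_same_card_bij[OF \<gamma>(1) \<beta>(1)] \<beta>(2) \<gamma>(2) assms(3) by auto
  then have "lin_iso K (ring.func_space K \<beta>) (ring.func_space K \<gamma>) (\<lambda>a. \<lambda>w\<in>\<gamma>. a (h w))"
    using assms(1) by (intro reindex_lin_iso[of K V]) (auto simp: vec_def)
  from lin_iso_comp[OF lin_iso_inv[OF \<beta>(3)] lin_iso_comp[OF this \<gamma>(3)]] show ?thesis by (rule that)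
qed

section \<open>Finite products of spaces\<close>

text \<open>The record copies the shape of \<open>total\<close>, so that \<open>total P M\<close> is
  the product of the family \<open>ob M\<close>; an arbitrary family \<open>V\<close> also covers
  the images of the shifts.\<close>

definition prod_space :: "'p set \<Rightarrow> ('p \<Rightarrow> ('a, 'v) module) \<Rightarrow> ('a, 'p \<Rightarrow> 'v) module" where
  "prod_space P V = \<lparr>
     carrier = (\<Pi>\<^sub>E p\<in>P. carrier (V p)),
     mult = (\<lambda>m n. \<lambda>p\<in>P. \<zero>\<^bsub>V p\<^esub>),
     one = (\<lambda>p\<in>P. \<zero>\<^bsub>V p\<^esub>),
     zero = (\<lambda>p\<in>P. \<zero>\<^bsub>V p\<^esub>),
     add = (\<lambda>m n. \<lambda>p\<in>P. m p \<oplus>\<^bsub>V p\<^esub> n p),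
     smult = (\<lambda>c m. \<lambda>p\<in>P. c \<odot>\<^bsub>V p\<^esub> m p)\<rparr>"

lemma prod_space_simps [simp]:
  "carrier (prod_space P V) = (\<Pi>\<^sub>E p\<in>P. carrier (V p))"
  "\<zero>\<^bsub>prod_space P V\<^esub> = (\<lambda>p\<in>P. \<zero>\<^bsub>V p\<^esub>)"
  "m \<oplus>\<^bsub>prod_space P V\<^esub> n = (\<lambda>p\<in>P. m p \<oplus>\<^bsub>V p\<^esub> n p)"
  "c \<odot>\<^bsub>prod_space P V\<^esub> m = (\<lambda>p\<in>P. c \<odot>\<^bsub>V p\<^esub> m p)"
  by (simp_all add: prod_space_def)

lemma prod_space_vectorspace:
  assumes "field K" "\<And>p. p \<in> P \<Longrightarrow> vectorspace K (V p)"
  shows "vectorspace K (prod_space P V)"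
proof -
  interpret K: field K by fact
  note closed = vectorspace_closed[OF assms(2)]
  have m: "module K (V p)" if "p \<in> P" for p
    using assms(2)[OF that] by (simp add: vectorspace_def)
  then have ab: "abelian_group (V p)" if "p \<in> P" for p
    using that by (simp add: module_def)
  have "abelian_group (prod_space P V)"
  proof (rule abelian_groupI)
    fix x assume x: "x \<in> carrier (prod_space P V)"
    show "\<exists>y\<in>carrier (prod_space P V). y \<oplus>\<^bsub>prod_space P V\<^esub> x = \<zero>\<^bsub>prod_space P V\<^esub>"
      using x abelian_group.a_inv_closed[OF ab] abelian_group.l_neg[OF ab]
      by (intro bexI[of _ "\<lambda>p\<in>P. \<ominus>\<^bsub>V p\<^esub> x p"]) (auto simp: PiE_iff intro!: restrict_ext)
  next
    fix x y z assume "x \<in> carrier (prod_space P V)" "y \<in> carrier (prod_space P V)"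
      "z \<in> carrier (prod_space P V)"
    then show "x \<oplus>\<^bsub>prod_space P V\<^esub> y \<oplus>\<^bsub>prod_space P V\<^esub> z =
        x \<oplus>\<^bsub>prod_space P V\<^esub> (y \<oplus>\<^bsub>prod_space P V\<^esub> z)"
      using abelian_monoid.a_assoc[OF abelian_group.axioms(1)[OF ab]]
      by (auto simp: PiE_iff intro!: restrict_ext)
  next
    fix x y assume "x \<in> carrier (prod_space P V)" "y \<in> carrier (prod_space P V)"
    then show "x \<oplus>\<^bsub>prod_space P V\<^esub> y = y \<oplus>\<^bsub>prod_space P V\<^esub> x"
      using abelian_monoid.a_comm[OF abelian_group.axioms(1)[OF ab]]
      by (auto simp: PiE_iff intro!: restrict_ext)
  next
    fix x assume x: "x \<in> carrier (prod_space P V)"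
    then show "\<zero>\<^bsub>prod_space P V\<^esub> \<oplus>\<^bsub>prod_space P V\<^esub> x = x"
      using abelian_monoid.l_zero[OF abelian_group.axioms(1)[OF ab]]
      by (auto simp: fun_eq_iff PiE_iff extensional_def)
  qed (use closed in \<open>auto simp: PiE_iff\<close>)
  moreover have "module_axioms K (prod_space P V)"
    using closed
    by unfold_locales
      (auto simp: module.smult_l_distr[OF m] module.smult_r_distr[OF m] module.smult_assoc1[OF m]
         module.smult_one[OF m] fun_eq_iff PiE_iff extensional_def)
  ultimately show ?thesis
    by (simp add: vectorspace_def module_def K.cring_axioms assms(1))
qed

text \<open>Induction on \<open>P\<close>: splitting off one factor turns the product into a direct
  sum of two spaces, and dimensions add.\<close>

lemma prod_space_vec:
  assumes "field K" "finite P" "\<And>p. p \<in> P \<Longrightarrow> V p \<in> vec K"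
  shows "prod_space P V \<in> vec K \<and>
    vectorspace.dim K (prod_space P V) = (\<Sum>p\<in>P. vectorspace.dim K (V p))"
  using assms(2,3)
proof (induction P rule: finite_induct)
  case empty
  have "vectorspace K (prod_space {} V)" using assms(1) by (rule prod_space_vectorspace) auto
  then show ?case using zero_vec by fastforce
next
  case (insert q P)
  have vs: "vectorspace K (V p)" if "p \<in> insert q P" for p
    using insert.prems[OF that] by (simp add: vec_def)
  let ?D = "direct_sum (V q) (prod_space P V)" and ?f = "\<lambda>(v, m). m(q := v)"
  have IH: "prod_space P V \<in> vec K" using insert by auto
  then have D: "?D \<in> vec K" using direct_sum_vec[of "V q"] insert by auto
  have "linear_map K ?D (prod_space (insert q P) V) ?f"
    using D assms(1) insert.hyps(2) vs
    by (intro linear_mapI prod_space_vectorspace)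
      (auto simp: vec_def fun_eq_iff PiE_iff extensional_def)
  moreover have "bij_betw ?f (carrier ?D) (carrier (prod_space (insert q P) V))"
    using insert.hyps(2)
    \<comment> \<open>The inverse resets the value at \<open>q\<close> to \<open>undefined\<close>,
      because elements of the smaller product are extensional on \<open>P\<close>, which omits
      \<open>q\<close>.\<close>
    by (intro bij_betwI[where g = "\<lambda>m. (m q, m(q := undefined))"])
      (auto simp: fun_eq_iff PiE_iff extensional_def split: if_splits)
  ultimately have iso: "lin_iso K ?D (prod_space (insert q P) V) ?f" by (simp add: lin_iso_def)
  show ?case
    using lin_iso_vec[OF D iso] dim_direct_sum[OF insert.prems[of q] IH] insert by auto
qed

section \<open>Ranks of structure maps\<close>

lemma repsD:
  assumes "M \<in> reps K P"
  shows "\<And>p. p \<in> P \<Longrightarrow> ob M p \<in> vec K"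
    and "\<And>p q. p \<in> P \<Longrightarrow> q \<in> P \<Longrightarrow> p \<le> q \<Longrightarrow> linear_map K (ob M p) (ob M q) (mp M p q)"
    and "\<And>p v. p \<in> P \<Longrightarrow> v \<in> carrier (ob M p) \<Longrightarrow> mp M p p v = v"
    and "\<And>p q r v. p \<in> P \<Longrightarrow> q \<in> P \<Longrightarrow> r \<in> P \<Longrightarrow> p \<le> q \<Longrightarrow> q \<le> r \<Longrightarrow>
      v \<in> carrier (ob M p) \<Longrightarrow> mp M p r v = mp M q r (mp M p q v)"
proof -
  have 1: "\<forall>p\<in>P. ob M p \<in> vec K"
    and 2: "\<forall>p\<in>P. \<forall>q\<in>P. p \<le> q \<longrightarrow> linear_map K (ob M p) (ob M q) (mp M p q)"
    and 3: "\<forall>p\<in>P. \<forall>v\<in>carrier (ob M p). mp M p p v = v"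
    and 4: "\<forall>p\<in>P. \<forall>q\<in>P. \<forall>r\<in>P. p \<le> q \<longrightarrow> q \<le> r \<longrightarrow>
        (\<forall>v\<in>carrier (ob M p). mp M p r v = mp M q r (mp M p q v))"
    using assms unfolding reps_def mem_Collect_eq by - (elim conjE, assumption)+
  show "\<And>p. p \<in> P \<Longrightarrow> ob M p \<in> vec K" using 1 by blast
  show "\<And>p q. p \<in> P \<Longrightarrow> q \<in> P \<Longrightarrow> p \<le> q \<Longrightarrow> linear_map K (ob M p) (ob M q) (mp M p q)"
    using 2 by blast
  show "\<And>p v. p \<in> P \<Longrightarrow> v \<in> carrier (ob M p) \<Longrightarrow> mp M p p v = v" using 3 by blast
  show "mp M p r v = mp M q r (mp M p q v)"
    if "p \<in> P" "q \<in> P" "r \<in> P" "p \<le> q" "q \<le> r" "v \<in> carrier (ob M p)" for p q r v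
    using 4[rule_format, OF that] .
qed

section \<open>Direct sums of representations and change of the carrier type\<close>

lemma rep_sum_reps:
  fixes M :: "('p::order, 'a, 'v) rep" and N :: "('p, 'a, 'w) rep"
  assumes "M \<in> reps K P" "N \<in> reps K P"
  shows "rep_sum M N \<in> reps K P"
proof -
  have "linear_map K (direct_sum (ob M p) (ob N p)) (direct_sum (ob M q) (ob N q))
      (map_prod (mp M p q) (mp N p q))" if "p \<in> P" "q \<in> P" "p \<le> q" for p q
    using linear_mapD[OF repsD(2)[OF assms(1) that]] linear_mapD[OF repsD(2)[OF assms(2) that]]
    by (intro linear_mapI direct_sum_is_vs) (auto simp: map_prod_def)
  then show ?thesis
    unfolding reps_def mem_Collect_eq
    by (auto simp: rep_sum_def direct_sum_vec repsD(1,3)[OF assms(1)] repsD(1,3)[OF assms(2)]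
        repsD(4)[OF assms(1), symmetric] repsD(4)[OF assms(2), symmetric])
qed

text \<open>Transport of structure along pointwise isomorphisms. A direct sum has its carriers in a
  product type, where \<alpha> is not defined; this yields an isomorphic object over
  \<open>'v\<close>.\<close>

lemma rep_transport:
  fixes N :: "('p::order, 'a, 'w) rep"
  assumes "N \<in> reps K P" "has_all_dims K TYPE('v)"
  obtains Z :: "('p, 'a, 'v) rep" where "Z \<in> reps K P" "rep_iso K P Z N"
proof -
  note N = repsD[OF assms(1)]
  have "\<forall>p. \<exists>(V :: ('a, 'v) module) f. p \<in> P \<longrightarrow> V \<in> vec K \<and> lin_iso K V (ob N p) f"
    using assms(2) N(1) lin_iso_exists unfolding has_all_dims_def by metis
  then obtain V :: "'p \<Rightarrow> ('a, 'v) module" and f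
    where V: "\<And>p. p \<in> P \<Longrightarrow> V p \<in> vec K" and f: "\<And>p. p \<in> P \<Longrightarrow> lin_iso K (V p) (ob N p) (f p)"
    by metis
  define g where "g p = inv_into (carrier (V p)) (f p)" for p
  have g: "lin_iso K (ob N p) (V p) (g p)" if "p \<in> P" for p
    using lin_iso_inv[OF f[OF that]] by (simp add: g_def)
  have fc: "f p v \<in> carrier (ob N p)" and gf: "g p (f p v) = v"
    if "p \<in> P" "v \<in> carrier (V p)" for p v
    using f[OF that(1)] that(2) by (auto simp: lin_iso_def g_def bij_betw_def)
  have fg: "f p (g p w) = w" if "p \<in> P" "w \<in> carrier (ob N p)" for p w
    using f[OF that(1)] that(2) by (auto simp: lin_iso_def g_def bij_betw_def f_inv_into_f)
  have mc: "mp N p q w \<in> carrier (ob N q)"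
    if "p \<in> P" "q \<in> P" "p \<le> q" "w \<in> carrier (ob N p)" for p q w
    using linear_mapD(3)[OF N(2)[OF that(1-3)] that(4)] .
  \<comment> \<open>The structure maps of \<open>N\<close> are conjugated by the isomorphisms
    \<open>f\<close>, with inverses \<open>g\<close>.\<close>
  define Z :: "('p, 'a, 'v) rep" where "Z = \<lparr>ob = V, mp = (\<lambda>p q v. g q (mp N p q (f p v)))\<rparr>"
  have "linear_map K (V p) (V q) (\<lambda>v. g q (mp N p q (f p v)))" if "p \<in> P" "q \<in> P" "p \<le> q" for p q
    using linear_map_comp[OF linear_map_comp[OF _ N(2)[OF that]]] f[OF that(1)] g[OF that(2)]
    unfolding lin_iso_def by blast
  then have "Z \<in> reps K P"
    unfolding reps_def mem_Collect_eq
    by (intro conjI ballI impI)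
      (simp_all add: Z_def V fc gf fg mc N(3) N(4)[symmetric])
  moreover have "rep_iso K P Z N"
    unfolding rep_iso_def using f
    by (intro exI[of _ f]) (auto simp: Z_def lin_iso_def fc fg mc)
  ultimately show ?thesis by (rule that)
qed

definition rk :: "('a, 'k) ring_scheme \<Rightarrow> ('p, 'a, 'v) rep \<Rightarrow> 'p \<Rightarrow> 'p \<Rightarrow> nat" where
  "rk K M p q = vectorspace.dim K ((ob M q)\<lparr>carrier := mp M p q ` carrier (ob M p)\<rparr>)"

text \<open>The component of the isomorphism at \<open>q\<close> restricts to an isomorphism between
  the images of the two structure maps.\<close>

lemma rk_iso:
  assumes "M \<in> reps K P" "rep_iso K P M N" "p \<in> P" "q \<in> P" "p \<le> q"
  shows "rk K M p q = rk K N p q"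
proof -
  obtain \<phi> where lin: "\<And>p. p \<in> P \<Longrightarrow> linear_map K (ob M p) (ob N p) (\<phi> p)"
    and bij: "\<And>p. p \<in> P \<Longrightarrow> bij_betw (\<phi> p) (carrier (ob M p)) (carrier (ob N p))"
    and nat: "\<And>v. v \<in> carrier (ob M p) \<Longrightarrow> \<phi> q (mp M p q v) = mp N p q (\<phi> p v)"
    using assms(2-5) unfolding rep_iso_def by blast
  let ?I = "mp M p q ` carrier (ob M p)" and ?J = "mp N p q ` carrier (ob N p)"
  note m = repsD(2)[OF assms(1,3-5)]
  have "(\<lambda>v. \<phi> q (mp M p q v)) ` carrier (ob M p) = mp N p q ` \<phi> p ` carrier (ob M p)"
    unfolding image_image using nat by (rule image_cong[OF refl])
  \<comment> \<open>Naturality together with surjectivity of the component at \<open>p\<close>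
    identifies the image in \<open>N\<close>.\<close>
  then have J: "?J = (\<lambda>v. \<phi> q (mp M p q v)) ` carrier (ob M p)"
    using bij[OF assms(3)] by (simp add: bij_betw_def)
  have "lin_iso K ((ob M q)\<lparr>carrier := ?I\<rparr>) ((ob N q)\<lparr>carrier := ?J\<rparr>) (\<phi> q)"
    unfolding lin_iso_def
  proof
    have I: "?I \<subseteq> carrier (ob M q)" using linear_mapD(3)[OF m] by auto
    show "linear_map K ((ob M q)\<lparr>carrier := ?I\<rparr>) ((ob N q)\<lparr>carrier := ?J\<rparr>) (\<phi> q)"
    proof (rule linear_mapI)
      show "vectorspace K ((ob N q)\<lparr>carrier := ?J\<rparr>)"
        unfolding J by (rule image_vectorspace[OF linear_map_comp[OF m lin[OF assms(4)]]])
    qed (use I linear_mapD[OF lin[OF assms(4)]] image_vectorspace[OF m] in \<open>auto simp: J subset_iff\<close>)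
    show "bij_betw (\<phi> q) (carrier ((ob M q)\<lparr>carrier := ?I\<rparr>)) (carrier ((ob N q)\<lparr>carrier := ?J\<rparr>))"
      using bij_betw_subset[OF bij[OF assms(4)] I, of ?J] by (simp add: J image_image)
  qed
  then show ?thesis
    using lin_iso_vec(2) image_vec[OF repsD(1)[OF assms(1,3)] m] by (auto simp: rk_def)
qed

text \<open>The image of a product map is the product of the images, so the restricted space is
  itself a direct sum.\<close>

lemma rk_sum:
  assumes "M \<in> reps K P" "N \<in> reps K P" "p \<in> P" "q \<in> P" "p \<le> q"
  shows "rk K (rep_sum M N) p q = rk K M p q + rk K N p q"
proof -
  have "(direct_sum (ob M q) (ob N q))\<lparr>carrier :=
      map_prod (mp M p q) (mp N p q) ` (carrier (ob M p) \<times> carrier (ob N p))\<rparr> =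
    direct_sum ((ob M q)\<lparr>carrier := mp M p q ` carrier (ob M p)\<rparr>)
      ((ob N q)\<lparr>carrier := mp N p q ` carrier (ob N p)\<rparr>)"
    by (auto simp: direct_sum_def)
  then show ?thesis
    using dim_direct_sum[OF image_vec[OF repsD(1,2)[OF assms(1)]]
        image_vec[OF repsD(1,2)[OF assms(2)]]] assms(3-5)
    by (simp add: rk_def rep_sum_def)
qed

section \<open>The one-dimensional space and the ranks of a spread representation\<close>

lemma self_module_simps [simp]:
  "carrier (self_module K) = carrier K"
  "v \<oplus>\<^bsub>self_module K\<^esub> w = v \<oplus>\<^bsub>K\<^esub> w"
  "c \<odot>\<^bsub>self_module K\<^esub> v = c \<otimes>\<^bsub>K\<^esub> v"
  "\<zero>\<^bsub>self_module K\<^esub> = \<zero>\<^bsub>K\<^esub>"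
  "(self_module K)\<lparr>carrier := carrier K\<rparr> = self_module K"
  by (simp_all add: self_module_def)

lemma self_module_vectorspace:
  assumes "field K"
  shows "vectorspace K (self_module K)" "vectorspace.dim K (self_module K) = 1"
proof -
  interpret K: field K by fact
  have "abelian_group (self_module K)"
    using K.l_neg by (intro abelian_groupI) (auto simp: K.a_ac)
  moreover have "module_axioms K (self_module K)"
    by unfold_locales (auto simp: K.l_distr K.r_distr K.m_assoc)
  ultimately show vs: "vectorspace K (self_module K)"
    by (simp add: vectorspace_def module_def K.cring_axioms assms)
  then interpret V: vectorspace K "self_module K" .
  have "submodule K (V.span {\<one>\<^bsub>K\<^esub>}) (self_module K)" by (rule V.span_is_submodule) simp
  from submodule.smult_closed[OF this] V.span_mem[of "{\<one>\<^bsub>K\<^esub>}" "\<one>\<^bsub>K\<^esub>"]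
  have "c \<in> V.span {\<one>\<^bsub>K\<^esub>}" if "c \<in> carrier K" for c using that by fastforce
  then have "V.gen_set {\<one>\<^bsub>K\<^esub>}" using V.span_closed[of "{\<one>\<^bsub>K\<^esub>}"] by auto
  then show "V.dim = 1" by (rule V.dim1I) auto
qed

lemma zero_subspace:
  assumes "vectorspace K V"
  shows "V\<lparr>carrier := {\<zero>\<^bsub>V\<^esub>}\<rparr> \<in> vec K" "vectorspace.dim K (V\<lparr>carrier := {\<zero>\<^bsub>V\<^esub>}\<rparr>) = 0"
proof -
  interpret vectorspace K V by fact
  have "submodule K {\<zero>\<^bsub>V\<^esub>} V" by (intro submodule.intro) (auto simp: module_axioms)
  then have "vectorspace K (V\<lparr>carrier := {\<zero>\<^bsub>V\<^esub>}\<rparr>)"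
    by (intro subspace_is_vs subspace.intro vectorspace_axioms)
  then show "V\<lparr>carrier := {\<zero>\<^bsub>V\<^esub>}\<rparr> \<in> vec K" "vectorspace.dim K (V\<lparr>carrier := {\<zero>\<^bsub>V\<^esub>}\<rparr>) = 0"
    using zero_vec by fastforce+
qed

lemma rk_spread_rep:
  assumes "field K"
  shows "rk K (spread_rep K S) p q = of_bool (p \<in> S \<and> q \<in> S)"
proof (cases "p \<in> S \<and> q \<in> S")
  case True
  then show ?thesis
    using self_module_vectorspace[OF assms] by (simp add: rk_def spread_rep_def)
next
  case False
  interpret K: field K by fact
  have "mp (spread_rep K S) p q ` carrier (ob (spread_rep K S) p) = {\<zero>\<^bsub>K\<^esub>}"
    using False by (auto simp: spread_rep_def)
  \<comment> \<open>Both branches of \<open>ob\<close> become the same record once the carrier is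
    replaced.\<close>
  moreover have "(ob (spread_rep K S) q)\<lparr>carrier := {\<zero>\<^bsub>K\<^esub>}\<rparr> = (self_module K)\<lparr>carrier := {\<zero>\<^bsub>K\<^esub>}\<rparr>"
    by (simp add: spread_rep_def)
  ultimately show ?thesis
    using False zero_subspace(2)[OF self_module_vectorspace(1)[OF assms]] by (simp add: rk_def)
qed

section \<open>The invariant in terms of ranks\<close>

lemma total_eq_prod_space: "total P M = prod_space P (ob M)"
  by (simp add: total_def prod_space_def)

text \<open>A subspace cut out degree by degree is again a product, so its dimension comes from
  \<open>prod_space_vec\<close>.\<close>

lemma prod_space_carrier_update:
  "(prod_space P V)\<lparr>carrier := (\<Pi>\<^sub>E p\<in>P. W p)\<rparr> = prod_space P (\<lambda>p. (V p)\<lparr>carrier := W p\<rparr>)"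
  by (simp add: prod_space_def)

text \<open>The shift is homogeneous, so preimages can be chosen in each degree separately.
  Nonemptiness of \<open>W p\<close> supplies a value where \<open>p + d\<close> leaves
  \<open>P\<close> and nothing is prescribed.\<close>

lemma shift_image:
  assumes "\<And>p. p \<in> P \<Longrightarrow> W p \<noteq> {}"
  shows "shift P M d ` (\<Pi>\<^sub>E p\<in>P. W p) =
    (\<Pi>\<^sub>E p\<in>P. if p - d \<in> P then mp M (p - d) p ` W (p - d) else {\<zero>\<^bsub>ob M p\<^esub>})" (is "?L = ?R")
proof
  show "?L \<subseteq> ?R"
  proof (rule image_subsetI)
    fix m assume "m \<in> (\<Pi>\<^sub>E p\<in>P. W p)"
    from PiE_mem[OF this] show "shift P M d m \<in> ?R" unfolding shift_def by (simp add: PiE_iff)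
  qed
  show "?R \<subseteq> ?L"
  proof
    fix n assume n: "n \<in> ?R"
    have "\<exists>w \<in> W p. p + d \<in> P \<longrightarrow> mp M p (p + d) w = n (p + d)" if "p \<in> P" for p
    proof (cases "p + d \<in> P")
      case True
      with PiE_mem[OF n this] that show ?thesis by auto
    qed (use assms[OF that] in auto)
    then obtain w where w: "\<And>p. p \<in> P \<Longrightarrow> w p \<in> W p"
      and nw: "\<And>p. p \<in> P \<Longrightarrow> p + d \<in> P \<Longrightarrow> mp M p (p + d) (w p) = n (p + d)"
      by metis
    have "shift P M d (restrict w P) = n"
    proof
      fix p
      show "shift P M d (restrict w P) p = n p"
      proof (cases "p \<in> P")
        case True
        then show ?thesis
          using PiE_mem[OF n True] nw[of "p - d"] by (auto simp: shift_def)
      next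
        case False
        then show ?thesis using PiE_arb[OF n] by (simp add: shift_def)
      qed
    qed
    moreover have "restrict w P \<in> (\<Pi>\<^sub>E p\<in>P. W p)" using w by auto
    ultimately show "n \<in> ?L" by blast
  qed
qed

text \<open>The dimension, in degree \<open>p\<close>, of the image of multiplication by the
  monomial of degree \<open>d\<close>.\<close>

definition rk_shift ::
  "('a, 'k) ring_scheme \<Rightarrow> (int \<times> int) set \<Rightarrow> (int \<times> int, 'a, 'v) rep \<Rightarrow> int \<times> int \<Rightarrow> int \<times> int \<Rightarrow> int" where
  "rk_shift K P M d p = (if p - d \<in> P then int (rk K M (p - d) p) else 0)"

lemma dim_shift_image:
  assumes "field K" "finite P" "M \<in> reps K P" "(0, 0) \<le> d"
  shows "int (vectorspace.dim K ((total P M)\<lparr>carrier :=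
      (\<Pi>\<^sub>E p\<in>P. if p - d \<in> P then mp M (p - d) p ` carrier (ob M (p - d)) else {\<zero>\<^bsub>ob M p\<^esub>})\<rparr>)) =
    (\<Sum>p\<in>P. rk_shift K P M d p)"
proof -
  define V where "V p = (ob M p)\<lparr>carrier :=
    if p - d \<in> P then mp M (p - d) p ` carrier (ob M (p - d)) else {\<zero>\<^bsub>ob M p\<^esub>}\<rparr>" for p
  have V: "V p \<in> vec K \<and> int (vectorspace.dim K (V p)) = rk_shift K P M d p" if p: "p \<in> P" for p
  proof (cases "p - d \<in> P")
    case True
    moreover have "p - d \<le> p" using assms(4) by (auto simp: less_eq_prod_def)
    ultimately show ?thesis
      using image_vec[OF repsD(1,2)[OF assms(3)]] p by (auto simp: V_def rk_shift_def rk_def)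
  next
    case False
    have "vectorspace K (ob M p)" using repsD(1)[OF assms(3) p] by (simp add: vec_def)
    with zero_subspace[OF this] False show ?thesis by (simp add: V_def rk_shift_def)
  qed
  then have "int (vectorspace.dim K (prod_space P V)) = (\<Sum>p\<in>P. rk_shift K P M d p)"
    using prod_space_vec[OF assms(1,2), of V] by (simp cong: sum.cong)
  then show ?thesis
    by (simp add: total_eq_prod_space prod_space_carrier_update V_def[abs_def])
qed

text \<open>Each of the four spaces in \<open>N2\<close> is a product over the grid, with factors
  the images of structure maps along \<open>(0, 0)\<close>, \<open>(1, 0)\<close>,
  \<open>(0, 1)\<close> and \<open>(1, 1)\<close>; hence its dimension is a sum of ranks.\<close>

lemma N2_eq_rk:
  assumes "field K" "M \<in> reps K (grid a b)"
  shows "N2 K (grid a b) M = (\<Sum>p\<in>grid a b. rk_shift K (grid a b) M (0, 0) p -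
    rk_shift K (grid a b) M (1, 0) p - rk_shift K (grid a b) M (0, 1) p +
    rk_shift K (grid a b) M (1, 1) p)"
proof -
  let ?P = "grid a b"
  define E where "E d p = (if p - d \<in> ?P then mp M (p - d) p ` carrier (ob M (p - d))
    else {\<zero>\<^bsub>ob M p\<^esub>})" for d p
  define dm where "dm W = int (vectorspace.dim K ((total ?P M)\<lparr>carrier := W\<rparr>))" for W
  have fin: "finite ?P" by (simp add: grid_def)
  have dm: "dm (\<Pi>\<^sub>E p\<in>?P. E d p) = (\<Sum>p\<in>?P. rk_shift K ?P M d p)" if "(0, 0) \<le> d" for d
    using dim_shift_image[OF assms(1) fin assms(2) that] by (simp add: dm_def E_def)
  have vs: "vectorspace K (ob M p)" if "p \<in> ?P" for p
    using repsD(1)[OF assms(2) that] by (simp add: vec_def)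
  have ne: "carrier (ob M p) \<noteq> {}" if "p \<in> ?P" for p
    using vectorspace_closed(3)[OF vs[OF that]] by auto
  have car: "carrier (total ?P M) = (\<Pi>\<^sub>E p\<in>?P. carrier (ob M p))"
    by (simp add: total_eq_prod_space)
  \<comment> \<open>The whole module is put into the same form, as the image under the shift by
    \<open>(0, 0)\<close>, where the structure maps are identities.\<close>
  have zero: "carrier (total ?P M) = (\<Pi>\<^sub>E p\<in>?P. E (0, 0) p)"
  proof -
    have "E (0, 0) p = carrier (ob M p)" if "p \<in> ?P" for p
      using that repsD(3)[OF assms(2) that]
      by (force simp: E_def simp flip: zero_prod_def)
    then show ?thesis unfolding car by (intro PiE_cong) simp
  qed
  have one: "shift ?P M d ` carrier (total ?P M) = (\<Pi>\<^sub>E p\<in>?P. E d p)" for d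
    unfolding car E_def by (rule shift_image[OF ne])
  have two: "shift ?P M (1, 0) ` shift ?P M (0, 1) ` carrier (total ?P M) = (\<Pi>\<^sub>E p\<in>?P. E (1, 1) p)"
  proof -
    have "E (0, 1) p \<noteq> {}" if "p \<in> ?P" for p using ne by (auto simp: E_def)
    then have "shift ?P M (1, 0) ` (\<Pi>\<^sub>E p\<in>?P. E (0, 1) p) =
      (\<Pi>\<^sub>E p\<in>?P. if p - (1, 0) \<in> ?P then mp M (p - (1, 0)) p ` E (0, 1) (p - (1, 0))
        else {\<zero>\<^bsub>ob M p\<^esub>})"
      by (rule shift_image)
    also have "\<dots> = (\<Pi>\<^sub>E p\<in>?P. E (1, 1) p)"
    proof (rule PiE_cong)
      fix p assume p: "p \<in> ?P"
      let ?q = "p - (1, 0)" and ?r = "p - (1, 1)"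
      have r: "?q - (0, 1) = ?r" by (cases p) simp
      have le: "?r \<le> ?q" "?q \<le> p" by (cases p; simp)+
      show "(if ?q \<in> ?P then mp M ?q p ` E (0, 1) ?q else {\<zero>\<^bsub>ob M p\<^esub>}) = E (1, 1) p"
      proof (cases "?r \<in> ?P")
        case True
        \<comment> \<open>The shape of the grid enters: it contains \<open>p\<close> and
          \<open>p - (1, 1)\<close>, hence also the corner \<open>p - (1, 0)\<close>, and
          functoriality composes the two maps.\<close>
        then have q: "?q \<in> ?P" using p by (cases p) (auto simp: grid_def)
        then have "mp M ?q p ` mp M ?r ?q ` carrier (ob M ?r) = mp M ?r p ` carrier (ob M ?r)"
          unfolding image_image using repsD(4)[OF assms(2) True q p le]
          by (intro image_cong) auto
        with True q show ?thesis by (simp add: E_def r)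
      next
        \<comment> \<open>Here the vertical shift contributes only zero at \<open>?q\<close>, and
          the horizontal map sends zero to zero.\<close>
        case False
        then show ?thesis
          using linear_mapD(6)[OF repsD(2)[OF assms(2) _ p le(2)]] by (simp add: E_def r)
      qed
    qed
    finally show ?thesis by (simp add: one)
  qed
  have "N2 K ?P M = dm (carrier (total ?P M)) - dm (shift ?P M (1, 0) ` carrier (total ?P M)) -
    dm (shift ?P M (0, 1) ` carrier (total ?P M)) +
    dm (shift ?P M (1, 0) ` shift ?P M (0, 1) ` carrier (total ?P M))"
    by (simp add: N2_def dm_def Let_def)
  also have "\<dots> = dm (\<Pi>\<^sub>E p\<in>?P. E (0, 0) p) - dm (\<Pi>\<^sub>E p\<in>?P. E (1, 0) p) -
    dm (\<Pi>\<^sub>E p\<in>?P. E (0, 1) p) + dm (\<Pi>\<^sub>E p\<in>?P. E (1, 1) p)"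
    \<comment> \<open>The double image has to be rewritten first, since \<open>one\<close> would
      already match its inner part.\<close>
    unfolding two unfolding one unfolding zero ..
  finally show ?thesis by (simp add: dm sum.distrib sum_subtractf)
qed

lemma rk_shift_sum:
  assumes "X \<in> reps K P" "Y \<in> reps K P" "Z \<in> reps K P" "rep_iso K P Z (rep_sum X Y)"
    "p \<in> P" "(0, 0) \<le> d"
  shows "rk_shift K P Z d p = rk_shift K P X d p + rk_shift K P Y d p"
proof -
  have "p - d \<le> p" using assms(6) by (auto simp: less_eq_prod_def)
  then show ?thesis
    using rk_iso[OF assms(3,4) _ assms(5)] rk_sum[OF assms(1,2) _ assms(5)]
    by (simp add: rk_shift_def)
qed

text \<open>Ranks are isomorphism invariant and add up over direct sums, term by term. The object
  \<open>Z\<close> replaces the sum itself so as to stay over one carrier type.\<close>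

lemma N2_sum:
  assumes "field K" "X \<in> reps K (grid a b)" "Y \<in> reps K (grid a b)" "Z \<in> reps K (grid a b)"
    "rep_iso K (grid a b) Z (rep_sum X Y)"
  shows "N2 K (grid a b) Z = N2 K (grid a b) X + N2 K (grid a b) Y"
  using rk_shift_sum[OF assms(2-5)]
  by (simp add: N2_eq_rk assms sum.distrib sum_subtractf)

section \<open>The Euler characteristic of a spread\<close>

text \<open>Only the minimum lacks its predecessor. This is the Euler characteristic of a path:
  vertices minus edges is 1.\<close>

lemma interval_card:
  fixes T :: "int set"
  assumes "finite T" "T \<noteq> {}" "\<And>i j k. i \<in> T \<Longrightarrow> k \<in> T \<Longrightarrow> i \<le> j \<Longrightarrow> j \<le> k \<Longrightarrow> j \<in> T"
  shows "card T = Suc (card {i \<in> T. i - 1 \<in> T})"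
proof -
  have "i - 1 \<in> T" if "i \<in> T" "i \<noteq> Min T" for i
    using assms(3)[of "Min T" i "i - 1"] Min_in[OF assms(1,2)] Min_le[OF assms(1) that(1)] that by auto
  moreover have "Min T - 1 \<notin> T" using Min_le[OF assms(1), of "Min T - 1"] by auto
  ultimately have "{i \<in> T. i - 1 \<in> T} = T - {Min T}" by auto
  then show ?thesis using card_Suc_Diff1[OF assms(1) Min_in[OF assms(1,2)]] by simp
qed

text \<open>Each occupied row is an interval, hence has one more point than horizontal edges; an
  edge is recorded by its right end.\<close>

lemma card_rows:
  fixes S :: "(int \<times> int) set"
  assumes "finite S" and conv: "\<And>h i k j. (h, j) \<in> S \<Longrightarrow> (k, j) \<in> S \<Longrightarrow> h \<le> i \<Longrightarrow> i \<le> k \<Longrightarrow> (i, j) \<in> S"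
  shows "card S = card {p \<in> S. p - (1, 0) \<in> S} + card (snd ` S)"
proof -
  define L where "L = {p \<in> S. p - (1, 0) \<notin> S}"
  \<comment> \<open>\<open>L\<close> consists of the leftmost points of the rows.\<close>
  have "inj_on snd L"
  proof (rule inj_onI)
    \<comment> \<open>The point left of \<open>(k, j)\<close> still lies between the two points, so
      convexity puts it into \<open>S\<close>.\<close>
    have *: False if "(h, j) \<in> L" "(k, j) \<in> L" "h < k" for h k j
      using conv[of h j k "k - 1"] that by (auto simp: L_def)
    fix p q assume "p \<in> L" "q \<in> L" "snd p = snd q"
    then show "p = q" using *[of "fst p" "snd p" "fst q"] *[of "fst q" "snd p" "fst p"]
      by (cases p; cases q) force
  qed
  moreover have "snd ` L = snd ` S"
  proof
    show "snd ` S \<subseteq> snd ` L"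
    proof
      fix j assume "j \<in> snd ` S"
      then obtain i where i: "(i, j) \<in> S" by auto
      let ?T = "{i. (i, j) \<in> S}"
      have fin: "finite ?T"
        using finite_imageI[OF assms(1), of fst] by (rule finite_subset[rotated]) force
      have "Min ?T \<in> ?T" using i by (intro Min_in fin) auto
      moreover have "Min ?T - 1 \<notin> ?T" using Min_le[OF fin, of "Min ?T - 1"] by auto
      ultimately show "j \<in> snd ` L" by (intro image_eqI[of _ _ "(Min ?T, j)"]) (auto simp: L_def)
    qed
  qed (auto simp: L_def)
  ultimately have "card L = card (snd ` S)" by (metis card_image)
  moreover have "S = {p \<in> S. p - (1, 0) \<in> S} \<union> L" by (auto simp: L_def)
  then have "card S = card {p \<in> S. p - (1, 0) \<in> S} + card L"
    using assms(1) by (subst (1) \<open>S = _\<close>, intro card_Un_disjoint) (auto simp: L_def)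
  ultimately show ?thesis by simp
qed

text \<open>The grid is itself convex in the integer plane, so \<open>q\<close> belongs to it
  automatically.\<close>

lemma spread_convexD:
  assumes "spread (grid a b) S" "p \<in> S" "r \<in> S" "p \<le> q" "q \<le> r"
  shows "q \<in> S"
proof -
  have "S \<subseteq> grid a b" and "poset_convex (grid a b) S" using assms(1) by (auto simp: spread_def)
  moreover from this(1) have "q \<in> grid a b"
    using assms(2-5) by (cases p; cases q; cases r) (auto simp: grid_def)
  ultimately show ?thesis using assms(2-5) unfolding poset_convex_def by blast
qed

text \<open>A path from below row \<open>j\<close> to row \<open>j\<close> or above makes a step \<open>x \<le> y\<close> across the boundary of row \<open>j\<close>,
  and convexity fills in the vertical edge above \<open>fst x\<close>.\<close>

lemma spread_crossing:
  assumes S: "spread (grid a b) S" and "u \<in> S" "v \<in> S" "snd u < j" "j \<le> snd v"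
  shows "\<exists>p\<in>S. snd p = j \<and> p - (0, 1) \<in> S"
proof (rule ccontr)
  assume no: "\<not> ?thesis"
  have "(u, v) \<in> {(x, y). x \<in> S \<and> y \<in> S \<and> (x \<le> y \<or> y \<le> x)}\<^sup>*"
    using assms by (auto simp: spread_def poset_connected_def)
  then have "snd v < j"
  proof (induction rule: rtrancl_induct)
    case (step x y)
    then have xy: "x \<in> S" "y \<in> S" "x \<le> y \<or> y \<le> x" by auto
    show ?case
    proof (rule ccontr)
      assume "\<not> snd y < j"
      \<comment> \<open>A step downwards from \<open>x\<close> would keep \<open>y\<close> below row
        \<open>j\<close>, so the step goes upwards.\<close>
      with step.IH xy have le: "x \<le> y" "j \<le> snd y" by (auto simp: less_eq_prod_def)
      then have "(fst x, j) \<in> S" "(fst x, j - 1) \<in> S"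
        using step.IH by (auto intro!: spread_convexD[OF S xy(1,2)] simp: less_eq_prod_def)
      then show False using no by force
    qed
  qed (use assms in simp)
  then show False using assms by simp
qed

text \<open>Points minus horizontal edges is the number of occupied rows. Vertical edges, recorded
  by their upper ends, minus squares is the number of rows containing such an end. The occupied rows
  form an interval joined by these edges, so the two numbers differ by 1.\<close>

lemma spread_euler_characteristic:
  assumes S: "spread (grid a b) S"
  shows "int (card S) - int (card {p \<in> S. p - (1, 0) \<in> S}) - int (card {p \<in> S. p - (0, 1) \<in> S})
    + int (card {p \<in> S. p - (1, 1) \<in> S}) = 1"
proof -
  let ?V = "{p \<in> S. p - (0, 1) \<in> S}" and ?R = "snd ` S"
  have fin: "finite S" and ne: "S \<noteq> {}"
    using S finite_subset[of S "grid a b"] by (auto simp: spread_def grid_def)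
  note conv = spread_convexD[OF S]
  have "card S = card {p \<in> S. p - (1, 0) \<in> S} + card ?R"
    using fin by (rule card_rows) (erule (1) conv; simp)
  \<comment> \<open>The rows of \<open>?V\<close> are convex too, by convexity of \<open>S\<close>
    at the upper and at the lower ends of the edges.\<close>
  moreover have "card ?V = card {p \<in> ?V. p - (1, 0) \<in> ?V} + card (snd ` ?V)"
  proof (rule card_rows)
    fix h i k j assume "(h, j) \<in> ?V" "(k, j) \<in> ?V" "h \<le> i" "i \<le> k"
    then show "(i, j) \<in> ?V"
      using conv[of "(h, j)" "(k, j)" "(i, j)"] conv[of "(h, j - 1)" "(k, j - 1)" "(i, j - 1)"]
      by simp
  qed (use fin in simp)
  \<comment> \<open>Two neighbouring vertical edges bound a square; conversely its other two corners
    lie between \<open>p - (1, 1)\<close> and \<open>p\<close>.\<close>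
  moreover have "{p \<in> ?V. p - (1, 0) \<in> ?V} = {p \<in> S. p - (1, 1) \<in> S}"
  proof -
    have eq: "p - (1, 0) - (0, 1) = p - (1, 1)" for p :: "int \<times> int" by (cases p) simp
    have "p - (0, 1) \<in> S" "p - (1, 0) \<in> S" if "p \<in> S" "p - (1, 1) \<in> S" for p
      by (rule conv[OF that(2,1)]; cases p; simp)+
    then show ?thesis unfolding set_eq_iff mem_Collect_eq eq by blast
  qed
  \<comment> \<open>Connectedness enters here: two consecutive occupied rows are joined by a
    vertical edge.\<close>
  moreover have "snd ` ?V = {j \<in> ?R. j - 1 \<in> ?R}"
  proof
    show "snd ` ?V \<subseteq> {j \<in> ?R. j - 1 \<in> ?R}" by force
    show "{j \<in> ?R. j - 1 \<in> ?R} \<subseteq> snd ` ?V"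
    proof
      fix j assume "j \<in> {j \<in> ?R. j - 1 \<in> ?R}"
      then obtain u v where "u \<in> S" "v \<in> S" "snd u < j" "j \<le> snd v" by force
      from spread_crossing[OF S this] show "j \<in> snd ` ?V" by force
    qed
  qed
  \<comment> \<open>No row is skipped, as a path from row \<open>i\<close> to row \<open>k\<close>
    has to cross into row \<open>j\<close>.\<close>
  moreover have "card ?R = Suc (card {j \<in> ?R. j - 1 \<in> ?R})"
  proof (rule interval_card)
    fix i j k assume i: "i \<in> ?R" and k: "k \<in> ?R" and le: "i \<le> j" "j \<le> k"
    show "j \<in> ?R"
    proof (cases "i = j")
      case False
      then obtain u v where "u \<in> S" "v \<in> S" "snd u < j" "j \<le> snd v" using i k le by force
      from spread_crossing[OF S this] show ?thesis by force
    qed (use i in simp)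
  qed (use fin ne in auto)
  ultimately show ?thesis by simp
qed

text \<open>Every rank is 0 or 1, and the four sums count points, horizontal edges, vertical edges
  and unit squares of the spread.\<close>

lemma N2_spread:
  assumes "field K" "X \<in> reps K (grid a b)" "is_spread_rep K (grid a b) X"
  shows "N2 K (grid a b) X = 1"
proof -
  let ?P = "grid a b"
  obtain S where S: "spread ?P S" and iso: "rep_iso K ?P X (spread_rep K S)"
    using assms(3) by (auto simp: is_spread_rep_def)
  have sub: "S \<subseteq> ?P" using S by (simp add: spread_def)
  have fin: "finite ?P" by (simp add: grid_def)
  \<comment> \<open>The default value 0 of \<open>rk_shift\<close> agrees with the indicator, as
    points outside the grid are outside \<open>S\<close>.\<close>
  have rk: "rk_shift K ?P X d p = of_bool (p \<in> S \<and> p - d \<in> S)" if "p \<in> ?P" "(0, 0) \<le> d" for p d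
  proof -
    have "p - d \<le> p" using that(2) by (auto simp: less_eq_prod_def)
    then show ?thesis
      using rk_iso[OF assms(2) iso _ that(1)] sub
      by (auto simp: rk_shift_def rk_spread_rep[OF assms(1)])
  qed
  have sum: "(\<Sum>p\<in>?P. rk_shift K ?P X d p) = int (card {p \<in> S. p - d \<in> S})" if "(0, 0) \<le> d" for d
  proof -
    have "(\<Sum>p\<in>?P. rk_shift K ?P X d p) = (\<Sum>p\<in>?P. of_bool (p \<in> S \<and> p - d \<in> S))"
      using rk that by (intro sum.cong) auto
    also have "\<dots> = int (card (?P \<inter> {p. p \<in> S \<and> p - d \<in> S}))"
      using fin by (subst sum_of_bool_eq) auto
    also have "?P \<inter> {p. p \<in> S \<and> p - d \<in> S} = {p \<in> S. p - d \<in> S}" using sub by auto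
    finally show ?thesis .
  qed
  have "{p \<in> S. p - (0, 0) \<in> S} = S" by (auto simp flip: zero_prod_def)
  then show ?thesis
    using spread_euler_characteristic[OF S] N2_eq_rk[OF assms(1,2)] sum
    by (simp add: sum.distrib sum_subtractf)
qed

section \<open>Relations between values of an additive invariant\<close>

context
  fixes K :: "('a, 'k) ring_scheme" and a b :: nat and A :: "('g, 'h) ring_scheme"
    and \<alpha> :: "(int \<times> int, 'a, 'v) rep \<Rightarrow> 'g"
  assumes K: "field K" and dims: "has_all_dims K TYPE('v)"
    and add: "additive_invariant K (grid a b) A \<alpha>"
begin

lemma invariant_closed: "X \<in> reps K (grid a b) \<Longrightarrow> \<alpha> X \<in> carrier A"
  using add by (simp add: additive_invariant_def)

lemma abelian_group_values: "abelian_group A"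
  using add by (simp add: additive_invariant_def)

text \<open>Realises a sum of two values of \<alpha>, and at the same time of \<open>N2\<close>, by
  one representation over \<open>'v\<close>.\<close>

lemma add_rep:
  assumes "X \<in> reps K (grid a b)" "Y \<in> reps K (grid a b)"
  obtains Z where "Z \<in> reps K (grid a b)" "\<alpha> Z = \<alpha> X \<oplus>\<^bsub>A\<^esub> \<alpha> Y"
    "N2 K (grid a b) Z = N2 K (grid a b) X + N2 K (grid a b) Y"
proof -
  obtain Z :: "(int \<times> int, 'a, 'v) rep"
    where Z: "Z \<in> reps K (grid a b)" "rep_iso K (grid a b) Z (rep_sum X Y)"
    using rep_transport[OF rep_sum_reps[OF assms] dims] .
  then have "\<alpha> Z = \<alpha> X \<oplus>\<^bsub>A\<^esub> \<alpha> Y" using add assms by (simp add: additive_invariant_def)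
  with Z N2_sum[OF K assms Z] show ?thesis by (intro that)
qed

text \<open>Only natural multiples arise as direct sums. The induction starts from \<open>X\<close>,
  so the case of no copies is realised without a zero representation.\<close>

lemma add_rep_multiple:
  assumes "X \<in> reps K (grid a b)" "Y \<in> reps K (grid a b)"
  obtains Z where "Z \<in> reps K (grid a b)" "\<alpha> Z = [n] \<cdot>\<^bsub>A\<^esub> \<alpha> Y \<oplus>\<^bsub>A\<^esub> \<alpha> X"
    "N2 K (grid a b) Z = int n * N2 K (grid a b) Y + N2 K (grid a b) X"
proof -
  interpret A: abelian_group A by (rule abelian_group_values)
  have "\<exists>Z\<in>reps K (grid a b). \<alpha> Z = [n] \<cdot>\<^bsub>A\<^esub> \<alpha> Y \<oplus>\<^bsub>A\<^esub> \<alpha> X \<and>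
    N2 K (grid a b) Z = int n * N2 K (grid a b) Y + N2 K (grid a b) X"
  proof (induction n)
    case 0
    show ?case using assms invariant_closed by (intro bexI[of _ X]) auto
  next
    case (Suc n)
    then obtain Z where Z: "Z \<in> reps K (grid a b)" "\<alpha> Z = [n] \<cdot>\<^bsub>A\<^esub> \<alpha> Y \<oplus>\<^bsub>A\<^esub> \<alpha> X"
      "N2 K (grid a b) Z = int n * N2 K (grid a b) Y + N2 K (grid a b) X" by blast
    obtain Z' where "Z' \<in> reps K (grid a b)" "\<alpha> Z' = \<alpha> Y \<oplus>\<^bsub>A\<^esub> \<alpha> Z"
      "N2 K (grid a b) Z' = N2 K (grid a b) Y + N2 K (grid a b) Z"
      using add_rep[OF assms(2) Z(1)] .
    then show ?case
      using Z assms invariant_closed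
      by (intro bexI[of _ Z']) (auto simp: A.a_ac algebra_simps)
  qed
  then show ?thesis using that by blast
qed

text \<open>Terms with a negative coefficient are moved to the other side, so that both sides of the
  relation remain values of \<open>\<alpha>\<close> at representations and \<open>finer\<close> applies.\<close>

lemma N2_of_relation:
  assumes finer: "finer K (grid a b) \<alpha> (N2 K (grid a b))"
    and "finite J" "\<And>i. i \<in> J \<Longrightarrow> B i \<in> reps K (grid a b)"
    and "M \<in> reps K (grid a b)" "M' \<in> reps K (grid a b)"
    and "\<alpha> M = (\<Oplus>\<^bsub>A\<^esub>i\<in>J. [c i] \<cdot>\<^bsub>A\<^esub> \<alpha> (B i)) \<oplus>\<^bsub>A\<^esub> \<alpha> M'"
  shows "N2 K (grid a b) M = (\<Sum>i\<in>J. (c i :: int) * N2 K (grid a b) (B i)) + N2 K (grid a b) M'"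
  using assms(2-)
\<comment> \<open>Both objects vary: a term with nonnegative coefficient is absorbed into
  \<open>M'\<close>, one with negative coefficient into \<open>M\<close>.\<close>
proof (induction J arbitrary: M M' rule: finite_induct)
  interpret A: abelian_group A by (rule abelian_group_values)
  case empty
  then have "\<alpha> M = \<alpha> M'" by (simp add: invariant_closed)
  \<comment> \<open>With no terms left, the relation is an equality of values of \<alpha> at two
    representations, the form in which \<open>finer\<close> is applied.\<close>
  with finer empty.prems(2,3) have "N2 K (grid a b) M = N2 K (grid a b) M'"
    unfolding finer_def by blast
  then show ?case by simp
next
  interpret A: abelian_group A by (rule abelian_group_values)
  case (insert j J)
  let ?N = "N2 K (grid a b)"
  let ?s = "\<Oplus>\<^bsub>A\<^esub>i\<in>J. [c i] \<cdot>\<^bsub>A\<^esub> \<alpha> (B i)"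
  have Bc: "\<alpha> (B i) \<in> carrier A" if "i \<in> insert j J" for i
    using insert.prems(1)[OF that] by (rule invariant_closed)
  then have s: "?s \<in> carrier A" by (intro A.finsum_closed) auto
  have j: "[z] \<cdot>\<^bsub>A\<^esub> \<alpha> (B j) \<in> carrier A" for z :: int using Bc by simp
  have M': "\<alpha> M' \<in> carrier A" using insert.prems(3) by (rule invariant_closed)
  have M: "\<alpha> M = [c j] \<cdot>\<^bsub>A\<^esub> \<alpha> (B j) \<oplus>\<^bsub>A\<^esub> ?s \<oplus>\<^bsub>A\<^esub> \<alpha> M'"
    using insert.prems(4) insert.hyps Bc by (subst (asm) A.finsum_insert) auto
  have Bj: "B j \<in> reps K (grid a b)" using insert.prems(1) by simp
  have "?N M = (\<Sum>i\<in>J. c i * ?N (B i)) + ?N M' + c j * ?N (B j)"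
  proof (cases "c j \<ge> 0")
    case True
    obtain Z where Z: "Z \<in> reps K (grid a b)"
      "\<alpha> Z = [nat (c j)] \<cdot>\<^bsub>A\<^esub> \<alpha> (B j) \<oplus>\<^bsub>A\<^esub> \<alpha> M'" "?N Z = int (nat (c j)) * ?N (B j) + ?N M'"
      using add_rep_multiple[OF insert.prems(3) Bj] .
    have "[nat (c j)] \<cdot>\<^bsub>A\<^esub> \<alpha> (B j) = [c j] \<cdot>\<^bsub>A\<^esub> \<alpha> (B j)"
      using True by (simp add: add_pow_int_ge)
    then have "\<alpha> M = ?s \<oplus>\<^bsub>A\<^esub> \<alpha> Z" unfolding M Z(2) using s j M' by (simp add: A.a_ac)
    from insert.IH[OF _ insert.prems(2) Z(1) this] insert.prems(1) Z(3) True show ?thesis by simp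
  next
    case False
    obtain Z where Z: "Z \<in> reps K (grid a b)"
      "\<alpha> Z = [nat (- c j)] \<cdot>\<^bsub>A\<^esub> \<alpha> (B j) \<oplus>\<^bsub>A\<^esub> \<alpha> M" "?N Z = int (nat (- c j)) * ?N (B j) + ?N M"
      using add_rep_multiple[OF insert.prems(2) Bj] .
    \<comment> \<open>Adding \<open>- c j\<close> copies of \<open>B j\<close> to \<open>M\<close>
      cancels the negative term of the relation.\<close>
    have "[nat (- c j)] \<cdot>\<^bsub>A\<^esub> \<alpha> (B j) \<oplus>\<^bsub>A\<^esub> [c j] \<cdot>\<^bsub>A\<^esub> \<alpha> (B j) = \<zero>\<^bsub>A\<^esub>"
      using False Bc[of j] by (simp add: add_pow_int_lt A.r_neg)
    then have "[nat (- c j)] \<cdot>\<^bsub>A\<^esub> \<alpha> (B j) \<oplus>\<^bsub>A\<^esub> ([c j] \<cdot>\<^bsub>A\<^esub> \<alpha> (B j) \<oplus>\<^bsub>A\<^esub> (?s \<oplus>\<^bsub>A\<^esub> \<alpha> M')) =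
        ?s \<oplus>\<^bsub>A\<^esub> \<alpha> M'"
      using s j[of "c j"] M' Bc[of j] by (simp flip: A.a_assoc)
    then have "\<alpha> Z = ?s \<oplus>\<^bsub>A\<^esub> \<alpha> M'"
      unfolding M Z(2) using s j[of "c j"] M' by (simp add: A.a_assoc)
    from insert.IH[OF _ Z(1) insert.prems(3) this] insert.prems(1) Z(3) False show ?thesis by simp
  qed
  then show ?case using insert.hyps by simp
qed

end

section \<open>Comparison of the sum of the coefficients with \<open>N2\<close>\<close>

theorem corollary4p8:
  fixes K :: "('a, 'k) ring_scheme"
    and a b :: nat
    and A :: "('g, 'h) ring_scheme"
    and \<alpha> :: "(int \<times> int, 'a, 'v) rep \<Rightarrow> 'g"
    and I :: "'i set"
    and B :: "'i \<Rightarrow> (int \<times> int, 'a, 'v) rep"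
  assumes "field K"
    and "has_all_dims K TYPE('v)"
    and "a \<ge> 1" and "b \<ge> 1"
    and "additive_invariant K (grid a b) A \<alpha>"
    and "is_basis K (grid a b) A \<alpha> I B"
    and "\<forall>i\<in>I. is_spread_rep K (grid a b) (B i)"
    and "finer K (grid a b) \<alpha> (N2 K (grid a b))"
  shows "\<forall>M\<in>reps K (grid a b). N_basis A \<alpha> I B M = N2 K (grid a b) M"
proof
  fix M :: "(int \<times> int, 'a, 'v) rep"
  assume M: "M \<in> reps K (grid a b)"
  note inv = assms(1,2,5)
  define c where "c = basis_coeffs A \<alpha> I B M"
  define J where "J = {i. c i \<noteq> 0}"
  have "\<exists>!c. is_expansion A \<alpha> I B M c" using assms(6) M unfolding is_basis_def by blast
  from theI'[OF this] have "is_expansion A \<alpha> I B M c" by (simp add: c_def basis_coeffs_def)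
  then have J: "finite J" "J \<subseteq> I" and exp: "\<alpha> M = (\<Oplus>\<^bsub>A\<^esub>i\<in>J. [c i] \<cdot>\<^bsub>A\<^esub> \<alpha> (B i))"
    unfolding is_expansion_def J_def by blast+
  have B: "B i \<in> reps K (grid a b)" if "i \<in> J" for i
    using assms(6) J that unfolding is_basis_def by blast
  \<comment> \<open>Adding \<open>M\<close> to both sides of the expansion gives the right-hand side
    the representation summand that \<open>N2_of_relation\<close> asks for; it cancels
    afterwards.\<close>
  obtain Z where Z: "Z \<in> reps K (grid a b)" "\<alpha> Z = \<alpha> M \<oplus>\<^bsub>A\<^esub> \<alpha> M"
    "N2 K (grid a b) Z = N2 K (grid a b) M + N2 K (grid a b) M"
    using add_rep[OF inv M M] .
  have "\<alpha> Z = (\<Oplus>\<^bsub>A\<^esub>i\<in>J. [c i] \<cdot>\<^bsub>A\<^esub> \<alpha> (B i)) \<oplus>\<^bsub>A\<^esub> \<alpha> M"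
    using Z(2) exp by simp
  from N2_of_relation[OF inv assms(8) J(1) B Z(1) M this]
  have "N2 K (grid a b) M = (\<Sum>i\<in>J. c i * N2 K (grid a b) (B i))" using Z(3) by simp
  also have "\<dots> = (\<Sum>i\<in>J. c i)"
    using N2_spread[OF assms(1) B] assms(7) J(2) by (intro sum.cong) auto
  finally show "N_basis A \<alpha> I B M = N2 K (grid a b) M"
    by (simp add: N_basis_def c_def J_def)
qed

end
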